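(* Let $n\in\mathbb{N}$, let $(V^n,\sim)$ be the $n$-th prefractal graph of the Sierpinski gasket $S\subset\mathbb{R}^2$ with boundary vertices $\Gamma=\{a_1,a_2,a_3\}$, $h_n=2^{-n}$, and let $f:S\to\mathbb{R}$ be continuous with $\inf_S f>0$. Let $g:\Gamma\to\mathbb{R}$ be such that $$g(x)\le\inf\Big\{\sum_{k=0}^{N}h_nf(x_k)+g(y)\Big\}\qquad\forall x,y\in\Gamma,$$ where the infimum is taken over all finite paths $\{x_0=x,x_1,\dots,x_N=y\}$ in $V^n$ with $x_i\sim x_{i+1}$, $i=0,\dots,N-1$. Then the unique solution $u:V^n\to\mathbb{R}$ of $$\max_{y\sim x}\Big\{-\frac1{h_n}\big(u(y)-u(x)\big)\Big\}=f(x)\quad\forall x\in V^n\setminus\Gamma$$ with the boundary condition $u=g$ on $\Gamma$ is given by $$u(x)=\min\Big\{\sum_{k=0}^{N}h_nf(x_k)+g(y)\Big\},$$ where the minimum is taken over all $y\in\Gamma$ and over all finite paths $\{x_0=x,x_1,\dots,x_N=y\}$ in $V^n$ with $x_i\sim x_{i+1}$, $i=0,\dots,N-1$.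
   Context: $a_1,a_2,a_3$ are the vertices of an equilateral triangle of side $1$ in $\mathbb{R}^2$, $\Gamma=\{a_1,a_2,a_3\}$, $\psi_i(x)=a_i+\frac12(x-a_i)$. $V^n$ is the union of the images of $\Gamma$ under all $n$-fold compositions $\psi_{i_1}\circ\dots\circ\psi_{i_n}$; for $x,y\in V^n$, $x\sim y$ iff the segment joining $x$ and $y$ is the image of a side of the initial triangle under some $\psi_{i_1}\circ\dots\circ\psi_{i_n}$ (so $|x-y|=h_n=2^{-n}$). $S$ is the closure of $\bigcup_nV^n$.
   Formalization: The sums, both in the condition on g and in the formula for u, run over k = 0,…,N−1 instead of k = 0,…,N: with the endpoint included the claim fails (f = 1, g = 0 would give u ≥ h_n > 0 on Γ, where u = g = 0). *)

theory Defs
  imports "HOL-Analysis.Analysis" "HOL-Library.FuncSet"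
begin

definition unit_equilateral :: "(3 \<Rightarrow> real^2) \<Rightarrow> bool" where
  "unit_equilateral a \<longleftrightarrow> (\<forall>i j. i \<noteq> j \<longrightarrow> dist (a i) (a j) = 1)"

definition bdry :: "(3 \<Rightarrow> real^2) \<Rightarrow> (real^2) set" where
  "bdry a = range a"

definition psi :: "(3 \<Rightarrow> real^2) \<Rightarrow> 3 \<Rightarrow> real^2 \<Rightarrow> real^2" where
  "psi a i x = a i + (1/2) *\<^sub>R (x - a i)"

(* psi_word a [i1, ..., in] is the composition of psi a i1, ..., psi a in, with psi a i1 outermost. *)
definition psi_word :: "(3 \<Rightarrow> real^2) \<Rightarrow> 3 list \<Rightarrow> real^2 \<Rightarrow> real^2" where
  "psi_word a w = foldr (\<lambda>i F. psi a i \<circ> F) w id"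

definition V :: "(3 \<Rightarrow> real^2) \<Rightarrow> nat \<Rightarrow> (real^2) set" where
  "V a n = (\<Union>w\<in>{w. length w = n}. psi_word a w ` bdry a)"

definition adj :: "(3 \<Rightarrow> real^2) \<Rightarrow> nat \<Rightarrow> real^2 \<Rightarrow> real^2 \<Rightarrow> bool" where
  "adj a n x y \<longleftrightarrow> x \<in> V a n \<and> y \<in> V a n \<and>
     (\<exists>w i j. length w = n \<and> i \<noteq> j \<and>
        closed_segment x y = psi_word a w ` closed_segment (a i) (a j))"

definition gasket :: "(3 \<Rightarrow> real^2) \<Rightarrow> (real^2) set" where
  "gasket a = closure (\<Union>n. V a n)"

definition h :: "nat \<Rightarrow> real" where
  "h n = 1 / 2 ^ n"

(* The path is X 0, ..., X N; values of X beyond N are irrelevant.  N = 0 is allowed when x = y. *)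
definition is_path ::
  "(3 \<Rightarrow> real^2) \<Rightarrow> nat \<Rightarrow> nat \<Rightarrow> (nat \<Rightarrow> real^2) \<Rightarrow> real^2 \<Rightarrow> real^2 \<Rightarrow> bool" where
  "is_path a n N X x y \<longleftrightarrow>
     X 0 = x \<and> X N = y \<and> (\<forall>k\<le>N. X k \<in> V a n) \<and> (\<forall>k<N. adj a n (X k) (X (Suc k)))"

(* The running cost is charged at X 0, ..., X (N - 1) only; summing up to and including the endpoint
   X N = y would make the representation formula false.  The equation says
   u x = h n * f x + Min {u y | y. adj a n x y}, so the cost at x is paid on leaving x, and at y
   only the exit cost g y remains.  With the endpoint included and f = 1, g = 0, every path would
   cost at least h n > 0, contradicting u = g on the boundary. *)
definition path_cost ::
  "nat \<Rightarrow> (real^2 \<Rightarrow> real) \<Rightarrow> (real^2 \<Rightarrow> real) \<Rightarrow> nat \<Rightarrow> (nat \<Rightarrow> real^2) \<Rightarrow> real" where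
  "path_cost n f g N X = (\<Sum>k<N. h n * f (X k)) + g (X N)"

definition is_solution ::
  "(3 \<Rightarrow> real^2) \<Rightarrow> nat \<Rightarrow> (real^2 \<Rightarrow> real) \<Rightarrow> (real^2 \<Rightarrow> real) \<Rightarrow> (real^2 \<Rightarrow> real) \<Rightarrow> bool" where
  "is_solution a n f g u \<longleftrightarrow>
     (\<forall>x\<in>V a n - bdry a. Max ((\<lambda>y. - (1 / h n) * (u y - u x)) ` {y. adj a n x y}) = f x) \<and>
     (\<forall>x\<in>bdry a. u x = g x)"

definition is_minimum :: "real set \<Rightarrow> real \<Rightarrow> bool" where
  "is_minimum C c \<longleftrightarrow> c \<in> C \<and> (\<forall>c'\<in>C. c \<le> c')"

end

(* The equation at an interior vertex x is the dynamic programming principle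
   u x = h n * f x + Min {u y | y. adj a n x y}.  A solution is bounded by the cost of every path
   to the boundary, by induction on the length of the path; when the path starts at a boundary
   vertex the compatibility condition on g takes over.  Following minimizing neighbours decreases a
   solution strictly, so on the finite vertex set this reaches the boundary, along a path whose cost
   is the value of the solution.  For existence, the infimum of the path costs satisfies the
   dynamic programming principle; it is finite because every vertex is connected to the boundary. *)

theory Submission
  imports Defs
begin

section \<open>The prefractal graphs\<close>

lemma psi_word_Nil [simp]: "psi_word a [] = id"
  by (simp add: psi_word_def)

lemma psi_word_Cons [simp]: "psi_word a (j # w) = psi a j \<circ> psi_word a w"
  by (simp add: psi_word_def)

lemma psi_midpoint: "psi a j x = midpoint (a j) x"
  by (simp add: psi_def midpoint_def vec_eq_iff field_simps)

lemma psi_image_closed_segment: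
  "psi a j ` closed_segment x y = closed_segment (psi a j x) (psi a j y)"
proof -
  have "psi a j = (\<lambda>z. (1/2) *\<^sub>R a j + z) \<circ> (\<lambda>z. (1/2) *\<^sub>R z)"
    by (auto simp: psi_def vec_eq_iff field_simps)
  then show ?thesis
    by (simp only: image_comp [symmetric] closed_segment_translation closed_segment_linear_image
        linear_scaleR comp_apply)
qed

lemma V_0: "V a 0 = bdry a"
  by (simp add: V_def)

text \<open>Splitting off the outermost map exhibits level \<open>Suc n\<close> as three scaled
  copies of level \<open>n\<close>, which is what inductions on the level use.\<close>

lemma V_Suc: "V a (Suc n) = (\<Union>j. psi a j ` V a n)"
  by (force simp: V_def length_Suc_conv)

text \<open>Each \<open>a i\<close> is the fixed point of \<open>psi a i\<close>, so corners survive
  every refinement.\<close>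

lemma bdry_subset_V: "bdry a \<subseteq> V a n"
proof (induction n)
  case 0
  then show ?case by (simp add: V_0)
next
  case (Suc n)
  have "a i \<in> psi a i ` V a n" for i
    using Suc by (intro image_eqI[of _ _ "a i"]) (auto simp: psi_midpoint bdry_def)
  then show ?case by (auto simp: V_Suc bdry_def)
qed

lemma finite_V: "finite (V a n)"
  by (induction n) (simp_all add: V_0 V_Suc bdry_def)

lemma finite_neighbours: "finite {y. adj a n x y}"
  by (rule finite_subset[OF _ finite_V[of a n]]) (auto simp: adj_def)

section \<open>Compactness of the gasket and lower bounds for \<open>f\<close>\<close>

lemma norm_V_le:
  assumes "\<And>i. norm (a i) \<le> M" and "x \<in> V a n"
  shows "norm x \<le> M"
  using assms(2)
proof (induction n arbitrary: x)
  case 0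
  then show ?case using assms(1) by (auto simp: V_0 bdry_def)
next
  case (Suc n)
  then obtain j z where z: "z \<in> V a n" "x = psi a j z"
    by (auto simp: V_Suc)
  have "norm (a j + z) \<le> M + M"
    using norm_triangle_mono[OF assms(1) Suc.IH[OF z(1)]] .
  then show ?case
    by (simp add: z(2) psi_midpoint midpoint_def)
qed

text \<open>The bound is uniform in \<open>n\<close>: averaging with a corner never leaves a ball
  about the origin that contains all corners.\<close>

lemma compact_gasket: "compact (gasket a)"
proof -
  obtain M where "\<And>i. norm (a i) \<le> M"
    using finite_imp_bounded[of "range a"] by (auto simp: bounded_iff)
  then have "bounded (\<Union>n. V a n)"
    unfolding bounded_iff using norm_V_le[of a M] by blast
  then show ?thesis
    by (simp add: gasket_def)
qed

lemma V_subset_gasket: "V a n \<subseteq> gasket a"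
  unfolding gasket_def by (rule order_trans[OF _ closure_subset]) blast

text \<open>A real \<open>INF\<close> is sure to be a lower bound only when the values are bounded
  below; compactness ensures this. The lemma turns the infimum hypothesis into positivity of
  \<open>f\<close> at the vertices.\<close>

lemma INF_gasket_le:
  fixes f :: "real^2 \<Rightarrow> real"
  assumes "continuous_on (gasket a) f" and "x \<in> gasket a"
  shows "(INF z\<in>gasket a. f z) \<le> f x"
  using assms compact_continuous_image compact_gasket
  by (intro cINF_lower bounded_imp_bdd_below compact_imp_bounded) auto

section \<open>Connectedness of the prefractal graphs\<close>

lemma adj_psi:
  assumes "adj a n x y"
  shows "adj a (Suc n) (psi a j x) (psi a j y)"
proof -
  obtain w i k where w: "length w = n" "i \<noteq> k"
      "closed_segment x y = psi_word a w ` closed_segment (a i) (a k)"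
    using assms by (auto simp: adj_def)
  have "closed_segment (psi a j x) (psi a j y) =
      psi_word a (j # w) ` closed_segment (a i) (a k)"
    by (simp add: psi_image_closed_segment[symmetric] w(3) image_comp)
  moreover have "length (j # w) = Suc n"
    using w(1) by simp
  ultimately show ?thesis
    using assms w(2) unfolding adj_def V_Suc by blast
qed

lemma connected_psi:
  assumes "(adj a n)\<^sup>*\<^sup>* x y"
  shows "(adj a (Suc n))\<^sup>*\<^sup>* (psi a j x) (psi a j y)"
  using assms
  by induction (auto intro: rtranclp.rtrancl_into_rtrancl adj_psi)

text \<open>A walk to \<open>a k\<close> is assembled from two scaled walks of the previous level,
  one in a cell containing \<open>x\<close> and one in the cell at \<open>a k\<close>.\<close>

lemma connected_bdry:
  assumes "x \<in> V a n"
  shows "(adj a n)\<^sup>*\<^sup>* x (a k)"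
  using assms
proof (induction n arbitrary: x k)
  case 0
  then obtain i where i: "x = a i"
    by (auto simp: V_0 bdry_def)
  have "adj a 0 (a i) (a k)" if "i \<noteq> k"
    using that by (force simp: adj_def V_0 bdry_def)
  then show ?case
    using i by (cases "i = k") auto
next
  case (Suc n)
  then obtain j z where z: "z \<in> V a n" "x = psi a j z"
    by (auto simp: V_Suc)
  have "a j \<in> V a n"
    using bdry_subset_V unfolding bdry_def by blast
  \<comment> \<open>The cells of \<open>j\<close> and \<open>k\<close> share the midpoint of \<open>a j\<close> and \<open>a k\<close>.\<close>
  have "(adj a (Suc n))\<^sup>*\<^sup>* x (psi a j (a k))"
    using z Suc.IH connected_psi by blast
  also have "psi a j (a k) = psi a k (a j)"
    by (simp add: psi_midpoint midpoint_sym)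
  also have "(adj a (Suc n))\<^sup>*\<^sup>* (psi a k (a j)) (psi a k (a k))"
    using Suc.IH \<open>a j \<in> V a n\<close> connected_psi by blast
  also have "psi a k (a k) = a k"
    by (simp add: psi_midpoint)
  finally show ?case .
qed

text \<open>A walk from \<open>x\<close> to \<open>a 0\<close> is nonempty and so has a first edge.
  Hence the \<open>Max\<close> in the equation is over a nonempty set.\<close>

lemma neighbour_exists:
  assumes "x \<in> V a n - bdry a"
  shows "\<exists>y. adj a n x y"
proof -
  have "(adj a n)\<^sup>*\<^sup>* x (a 0)" "x \<noteq> a 0"
    using assms connected_bdry by (auto simp: bdry_def)
  then show ?thesis
    by (meson converse_rtranclpE)
qed

section \<open>Paths and their costs\<close>

lemma h_pos: "0 < h n"
  by (simp add: h_def)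

lemma is_path_const: "x \<in> V a n \<Longrightarrow> is_path a n 0 (\<lambda>_. x) x x"
  by (simp add: is_path_def)

lemma is_path_Cons:
  assumes "adj a n x z" and "is_path a n N X z y"
  shows "is_path a n (Suc N) (case_nat x X) x y"
proof -
  have "case_nat x X k \<in> V a n" if "k \<le> Suc N" for k
    using that assms by (cases k) (simp_all add: is_path_def adj_def)
  moreover have "adj a n (case_nat x X k) (case_nat x X (Suc k))" if "k < Suc N" for k
    using that assms by (cases k) (simp_all add: is_path_def)
  ultimately show ?thesis
    using assms(2) by (simp add: is_path_def)
qed

lemma path_cost_Cons:
  "path_cost n f g (Suc N) (case_nat x X) = h n * f x + path_cost n f g N X"
  by (simp add: path_cost_def sum.lessThan_Suc_shift del: sum.lessThan_Suc)

lemma is_path_SucD: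
  assumes "is_path a n (Suc N) X x y"
  shows "adj a n x (X 1)" and "is_path a n N (\<lambda>k. X (Suc k)) (X 1) y"
  using assms by (auto simp: is_path_def)

lemma path_cost_Suc:
  "path_cost n f g (Suc N) X = h n * f (X 0) + path_cost n f g N (\<lambda>k. X (Suc k))"
  by (simp add: path_cost_def sum.lessThan_Suc_shift del: sum.lessThan_Suc)

lemma is_path_of_connected:
  assumes "(adj a n)\<^sup>*\<^sup>* x y" and "y \<in> V a n"
  shows "\<exists>N X. is_path a n N X x y"
  using assms(1)
  by (induction rule: converse_rtranclp_induct)
    (use assms(2) in \<open>blast intro: is_path_const is_path_Cons\<close>)+

lemma path_cost_ge:
  assumes pos: "\<forall>x\<in>V a n. 0 < f x" and "is_path a n N X x y"
  shows "g y \<le> path_cost n f g N X"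
proof -
  have "0 \<le> h n * f (X k)" if "k < N" for k
    using assms(2) that pos h_pos[of n] by (simp add: is_path_def less_imp_le)
  then have "0 \<le> (\<Sum>k<N. h n * f (X k))"
    by (intro sum_nonneg) simp
  then show ?thesis
    using assms(2) by (simp add: path_cost_def is_path_def)
qed

abbreviation exit_costs ::
  "(3 \<Rightarrow> real^2) \<Rightarrow> nat \<Rightarrow> (real^2 \<Rightarrow> real) \<Rightarrow> (real^2 \<Rightarrow> real) \<Rightarrow> real^2 \<Rightarrow> real set" where
  "exit_costs a n f g x \<equiv> {path_cost n f g N X |N X y. y \<in> bdry a \<and> is_path a n N X x y}"

lemma exit_costs_nonempty:
  assumes "x \<in> V a n"
  shows "exit_costs a n f g x \<noteq> {}"
proof -
  have "a 0 \<in> bdry a"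
    by (simp add: bdry_def)
  moreover from this have "\<exists>N X. is_path a n N X x (a 0)"
    using connected_bdry[OF assms] bdry_subset_V is_path_of_connected by blast
  ultimately show ?thesis by blast
qed

text \<open>Dropping the nonnegative running costs leaves an exit cost, and \<open>g\<close> takes
  finitely many values on the boundary.\<close>

lemma exit_costs_bdd_below:
  assumes "\<forall>x\<in>V a n. 0 < f x"
  shows "bdd_below (exit_costs a n f g x)"
proof (rule bdd_belowI)
  fix c assume "c \<in> exit_costs a n f g x"
  then obtain N X y where y: "y \<in> bdry a" "is_path a n N X x y" "c = path_cost n f g N X"
    by blast
  then have "Min (g ` bdry a) \<le> g y"
    by (intro Min_le) (auto simp: bdry_def)
  also have "\<dots> \<le> c"
    using y path_cost_ge[OF assms] by blast
  finally show "Min (g ` bdry a) \<le> c" .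
qed

section \<open>Solutions and the value function\<close>

text \<open>The \<open>Max\<close> of a finite nonempty set is \<open>f x\<close> iff
  \<open>f x\<close> is attained and is an upper bound; multiplying by \<open>h n > 0\<close> gives
  the two conjuncts.\<close>

lemma equation_iff_dynamic_programming:
  assumes "x \<in> V a n - bdry a"
  shows "Max ((\<lambda>y. - (1 / h n) * (u y - u x)) ` {y. adj a n x y}) = f x \<longleftrightarrow>
    (\<exists>y. adj a n x y \<and> u x = h n * f x + u y) \<and> (\<forall>y. adj a n x y \<longrightarrow> u x \<le> h n * f x + u y)"
proof -
  have "f x = - (1 / h n) * (u y - u x) \<longleftrightarrow> u x = h n * f x + u y"
    and "- (1 / h n) * (u y - u x) \<le> f x \<longleftrightarrow> u x \<le> h n * f x + u y" for y
    using h_pos[of n] by (auto simp: field_simps)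
  moreover have "Max ((\<lambda>y. - (1 / h n) * (u y - u x)) ` {y. adj a n x y}) = f x \<longleftrightarrow>
      (\<exists>y. adj a n x y \<and> f x = - (1 / h n) * (u y - u x)) \<and>
      (\<forall>y. adj a n x y \<longrightarrow> - (1 / h n) * (u y - u x) \<le> f x)"
    using neighbour_exists[OF assms] finite_neighbours by (subst Max_eq_iff) auto
  ultimately show ?thesis
    by (simp only:)
qed

lemma solution_le_path_cost:
  assumes sol: "is_solution a n f g u"
    and compat: "\<forall>x\<in>bdry a. \<forall>y\<in>bdry a. \<forall>N X. is_path a n N X x y \<longrightarrow>
      g x \<le> path_cost n f g N X"
    and "y \<in> bdry a" and "is_path a n N X x y"
  shows "u x \<le> path_cost n f g N X"
  using assms(4)
proof (induction N arbitrary: X x)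
  case 0
  then have "X 0 = y" "x = y"
    by (auto simp: is_path_def)
  then show ?case
    using sol \<open>y \<in> bdry a\<close> by (simp add: is_solution_def path_cost_def)
next
  case (Suc N)
  show ?case
  proof (cases "x \<in> bdry a")
    case True
    \<comment> \<open>No equation holds at a boundary vertex, which a path may also visit before its
      end; compatibility bounds the whole remaining path at once.\<close>
    then show ?thesis
      using compat True \<open>y \<in> bdry a\<close> Suc.prems sol by (simp add: is_solution_def)
  next
    case False
    have x: "X 0 = x" "x \<in> V a n - bdry a"
      using False Suc.prems by (auto simp: is_path_def)
    have "u x \<le> h n * f x + u (X 1)"
      using sol equation_iff_dynamic_programming[OF x(2)] x(2) is_path_SucD(1)[OF Suc.prems]
      by (metis is_solution_def)
    also have "u (X 1) \<le> path_cost n f g N (\<lambda>k. X (Suc k))"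
      using Suc.IH is_path_SucD(2)[OF Suc.prems] by blast
    finally show ?thesis
      by (simp add: path_cost_Suc x(1))
  qed
qed

lemma solution_in_exit_costs:
  assumes sol: "is_solution a n f g u"
    and pos: "\<forall>x\<in>V a n. 0 < f x"
    and "x \<in> V a n"
  shows "u x \<in> exit_costs a n f g x"
  using assms(3)
\<comment> \<open>Passing to a neighbour that attains the equation lowers \<open>u\<close> by
  \<open>h n * f x > 0\<close>, so this count of vertices with smaller value drops.\<close>
proof (induction "card {y \<in> V a n. u y < u x}" arbitrary: x rule: less_induct)
  case less
  show ?case
  proof (cases "x \<in> bdry a")
    case True
    then have "u x = path_cost n f g 0 (\<lambda>_. x)"
      using sol by (simp add: is_solution_def path_cost_def)
    then show ?thesis
      using True is_path_const[OF less.prems] by blast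
  next
    case False
    then obtain z where z: "adj a n x z" "u x = h n * f x + u z"
      using sol equation_iff_dynamic_programming[of x a n u f] less.prems
      unfolding is_solution_def by blast
    have zV: "z \<in> V a n" and "u z < u x"
      using z pos less.prems h_pos[of n] by (auto simp: adj_def)
    then have "{y \<in> V a n. u y < u z} \<subset> {y \<in> V a n. u y < u x}"
      by force
    then have "u z \<in> exit_costs a n f g z"
      using less.hyps zV finite_V by (simp add: psubset_card_mono)
    then obtain N X y where y: "y \<in> bdry a" "is_path a n N X z y" "u z = path_cost n f g N X"
      by blast
    have "u x = path_cost n f g (Suc N) (case_nat x X)"
      by (simp add: path_cost_Cons y(3) z(2))
    then show ?thesis
      using y(1) is_path_Cons[OF z(1) y(2)] by blast
  qed
qed

text \<open>Prescribing \<open>u\<close> only on the vertices lets the extensional restriction of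
  the infimum qualify.\<close>

lemma value_function_is_solution:
  assumes pos: "\<forall>x\<in>V a n. 0 < f x"
    and compat: "\<forall>x\<in>bdry a. \<forall>y\<in>bdry a. \<forall>N X. is_path a n N X x y \<longrightarrow>
      g x \<le> path_cost n f g N X"
    and u: "\<And>x. x \<in> V a n \<Longrightarrow> u x = Inf (exit_costs a n f g x)"
  shows "is_solution a n f g u"
proof -
  note bdd = exit_costs_bdd_below[OF pos, of g]
  have lower: "u x \<le> path_cost n f g N X"
    if "x \<in> V a n" "y \<in> bdry a" "is_path a n N X x y" for x y N X
    using that cInf_lower[OF _ bdd, of "path_cost n f g N X" x] by (auto simp: u)
  have greatest: "c \<le> u x"
    if "x \<in> V a n" "\<And>N X y. y \<in> bdry a \<Longrightarrow> is_path a n N X x y \<Longrightarrow> c \<le> path_cost n f g N X"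
    for x c
    unfolding u[OF that(1)] by (rule cInf_greatest[OF exit_costs_nonempty[OF that(1)]])
      (use that(2) in blast)
  have "u x = g x" if "x \<in> bdry a" for x
  proof (rule antisym)
    have x: "x \<in> V a n"
      using that bdry_subset_V by blast
    show "u x \<le> g x"
      using lower[OF x that is_path_const[OF x]] by (simp add: path_cost_def)
    show "g x \<le> u x"
      using greatest[OF x] compat that by blast
  qed
  moreover have "Max ((\<lambda>y. - (1 / h n) * (u y - u x)) ` {y. adj a n x y}) = f x"
    if x: "x \<in> V a n - bdry a" for x
  proof -
    have le: "u x \<le> h n * f x + u y" if xy: "adj a n x y" for y
    proof -
      \<comment> \<open>Prepending \<open>x\<close> to a path from \<open>y\<close> gives a
        competitor for \<open>u x\<close>.\<close>
      have "u x - h n * f x \<le> path_cost n f g N X" if "z \<in> bdry a" "is_path a n N X y z" for N X z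
        using lower[OF _ that(1) is_path_Cons[OF xy that(2)]] x by (simp add: path_cost_Cons)
      then have "u x - h n * f x \<le> u y"
        using xy greatest by (simp add: adj_def)
      then show ?thesis by simp
    qed
    \<comment> \<open>This minimizing neighbour will attain equality: every exit path from
      \<open>x\<close> starts with a step to some neighbour, whose value is at least
      \<open>u z\<close>.\<close>
    obtain z where z: "adj a n x z" and z_min: "\<And>y. adj a n x y \<Longrightarrow> u z \<le> u y"
      using arg_min_if_finite[OF finite_neighbours, of a n x u] neighbour_exists[OF x]
      by (metis empty_iff mem_Collect_eq not_less)
    have "h n * f x + u z \<le> path_cost n f g N X" if y: "y \<in> bdry a" "is_path a n N X x y" for N X y
    proof (cases N)
      case 0
      \<comment> \<open>A path of length 0 would put the interior vertex \<open>x\<close> on the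
        boundary.\<close>
      then show ?thesis using y x by (auto simp: is_path_def)
    next
      case (Suc M)
      note tail = is_path_SucD[OF y(2)[unfolded Suc]]
      have "u z \<le> u (X 1)"
        using z_min tail(1) by blast
      also have "\<dots> \<le> path_cost n f g M (\<lambda>k. X (Suc k))"
        using lower[OF _ y(1) tail(2)] tail(1) by (simp add: adj_def)
      finally show ?thesis
        using y(2) by (simp add: Suc path_cost_Suc is_path_def)
    qed
    then have "h n * f x + u z \<le> u x"
      using greatest x by blast
    then have "u x = h n * f x + u z"
      using le[OF z] by simp
    then show ?thesis
      using z le equation_iff_dynamic_programming[OF x, of u f] by blast
  qed
  ultimately show ?thesis
    by (simp add: is_solution_def)
qed

theorem proposition3p2:
  fixes a :: "3 \<Rightarrow> real^2" and n :: nat and f g :: "real^2 \<Rightarrow> real"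
  assumes "unit_equilateral a"
    and "continuous_on (gasket a) f"
    and "(INF x\<in>gasket a. f x) > 0"
    and "\<forall>x\<in>bdry a. \<forall>y\<in>bdry a.
           g x \<le> Inf {path_cost n f g N X |N X. is_path a n N X x y}"
  shows "(\<exists>!u. u \<in> extensional (V a n) \<and> is_solution a n f g u) \<and>
         (\<forall>u. is_solution a n f g u \<longrightarrow>
            (\<forall>x\<in>V a n. is_minimum
               {path_cost n f g N X |N X y. y \<in> bdry a \<and> is_path a n N X x y} (u x)))"
proof -
  have pos: "\<forall>x\<in>V a n. 0 < f x"
    using INF_gasket_le[OF assms(2)] V_subset_gasket assms(3) by (meson less_le_trans subsetD)
  have "g x \<le> path_cost n f g N X"
    if "x \<in> bdry a" "y \<in> bdry a" "is_path a n N X x y" for x y N X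
  proof -
    have "bdd_below {path_cost n f g N X |N X. is_path a n N X x y}"
      by (rule bdd_belowI[of _ "g y"]) (auto intro: path_cost_ge[OF pos])
    then have "Inf {path_cost n f g N X |N X. is_path a n N X x y} \<le> path_cost n f g N X"
      using that(3) by (intro cInf_lower) auto
    then show ?thesis
      using assms(4) that(1,2) by (meson order_trans)
  qed
  then have compat: "\<forall>x\<in>bdry a. \<forall>y\<in>bdry a. \<forall>N X. is_path a n N X x y \<longrightarrow>
      g x \<le> path_cost n f g N X"
    by blast
  have minimum: "is_minimum (exit_costs a n f g x) (u x)"
    if "is_solution a n f g u" "x \<in> V a n" for u x
    unfolding is_minimum_def
    using solution_in_exit_costs[OF that(1) pos that(2)] solution_le_path_cost[OF that(1) compat]
    by blast
  \<comment> \<open>No separate comparison argument: two solutions are minima of the same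
    set.\<close>
  have unique: "u x = v x"
    if "is_solution a n f g u" "is_solution a n f g v" "x \<in> V a n" for u v x
    using minimum[OF that(1,3)] minimum[OF that(2,3)] unfolding is_minimum_def by (meson antisym)
  have "\<exists>!u. u \<in> extensional (V a n) \<and> is_solution a n f g u"
  proof (rule ex_ex1I)
    \<comment> \<open>Restriction fixes the values off the vertex set, where
      \<open>is_solution\<close> imposes nothing.\<close>
    have "is_solution a n f g (restrict (\<lambda>x. Inf (exit_costs a n f g x)) (V a n))"
      by (rule value_function_is_solution[OF pos compat]) simp_all
    then show "\<exists>u. u \<in> extensional (V a n) \<and> is_solution a n f g u"
      using restrict_extensional by blast
  qed (blast intro: extensionalityI unique)
  then show ?thesis
    using minimum by blast
qed

end
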